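(* Let $p\in[1,\infty]$ and let $f_0:\mathbb{R}\times\mathbb{R}\to\mathbb{R}$. Assume that $f_0\in L^1(\mathbb{R}^2)\cap L^p(\mathbb{R}^2)$ if $p\in[1,\infty)$, and that $f_0\in L^1(\mathbb{R}^2)\cap L^\infty(\mathbb{R}^2)\cap C^0(\mathbb{R}^2)$ if $p=\infty$. Then the solution $\tilde g$ of the self-similar Kolmogorov equation $$\partial_s \tilde{g} = 2(1-e^{-s})\, \partial_{\tilde{v}\tilde{z}} \tilde{g} + \partial_{\tilde{v}}^2 \tilde{g} + (1-e^{-s})^2\, \partial_{\tilde{z}}^2 \tilde{g} + \tfrac{1}{2} \tilde{v}\, \partial_{\tilde{v}} \tilde{g} + \tfrac{3}{2} \tilde{z}\, \partial_{\tilde{z}} \tilde{g}+2\tilde{g}$$ on $\mathbb{R}_+\times\mathbb{R}\times\mathbb{R}$ with initial Cauchy datum $\tilde g(0,\cdot,\cdot)=f_0$ satisfies $$\lim_{s\to\infty}\|\tilde g(s,\cdot,\cdot)-M_0\,G_1\|_{L^p(\mathbb{R}^2)}=0,\qquad\text{where } M_0=\int_{\mathbb{R}^2} f_0(v,x)\,dv\,dx .$$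
   Context: For $t>0$, $$G_t(v,z)=\frac{\sqrt{3}}{2\pi t^2}\exp\left(-\frac{1}{4t^3}\left(3z^2+(2tv-3z)^2\right)\right),$$ so that $G_1$ is this kernel at $t=1$. The Kolmogorov equation is $\partial_t f-\partial_v^2 f-v\,\partial_x f=0$ with initial datum $f_0$. Setting $f(t,v,x)=g(t,v,x+tv)=g(t,v,z)$, it becomes $\partial_t g=\partial_v^2 g+2t\,\partial_{vz}g+t^2\partial_z^2 g$, $g(0,\cdot,\cdot)=f_0$, whose solution on $\mathbb{R}^2$ is the convolution $g(t,v,z)=(G_t*f_0)(v,z)=\int_{\mathbb{R}^2}G_t(\nu,\zeta)f_0(v-\nu,z-\zeta)\,d\nu\,d\zeta$. The self-similar change of variables is $\tilde g(s,\tilde v,\tilde z)=e^{2s}\,g(e^s-1,e^{s/2}\tilde v,e^{3s/2}\tilde z)$, which transforms the equation for $g$ into the self-similar equation. The solution $\tilde g$ of the self-similar equation with initial datum $f_0$ is understood as the one given by these formulas, i.e. $\tilde g(s,\tilde v,\tilde z)=e^{2s}(G_{e^s-1}*f_0)(e^{s/2}\tilde v,e^{3s/2}\tilde z)$ for $s>0$. *)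

theory Defs
  imports "HOL-Analysis.Analysis" "HOL-Probability.Essential_Supremum"
begin

text \<open>
  The exponent ranges over the extended nonnegative reals, with \<open>p = \<infinity>\<close> for the essential
  supremum.  Non-measurable functions get norm \<open>\<infinity>\<close> for every exponent (the constant
  \<^const>\<open>esssup\<close> already follows this convention), and so does a measurable function whose
  \<open>p\<close>-th power has infinite integral; hence a finite norm means membership in the Lebesgue space.
\<close>

definition Lp_norm :: "'a measure \<Rightarrow> ennreal \<Rightarrow> ('a \<Rightarrow> real) \<Rightarrow> ennreal" where
  "Lp_norm M p f =
     (if f \<notin> borel_measurable M then \<infinity>
      else if p = \<infinity> then esssup M (\<lambda>x. ennreal \<bar>f x\<bar>)
      else (let I = (\<integral>\<^sup>+ x. ennreal (\<bar>f x\<bar> powr enn2real p) \<partial>M)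
            in if I = \<infinity> then \<infinity> else ennreal (enn2real I powr (1 / enn2real p))))"

definition Lp_space :: "'a measure \<Rightarrow> ennreal \<Rightarrow> ('a \<Rightarrow> real) set" where
  "Lp_space M p = {f. f \<in> borel_measurable M \<and> Lp_norm M p f < \<infinity>}"

definition kolmogorov_kernel :: "real \<Rightarrow> real \<times> real \<Rightarrow> real" where
  "kolmogorov_kernel t = (\<lambda>(v, z).
     sqrt 3 / (2 * pi * t\<^sup>2) * exp (- (1 / (4 * t ^ 3)) * (3 * z\<^sup>2 + (2 * t * v - 3 * z)\<^sup>2)))"

text \<open>
  The solution \<open>g(t, v, z)\<close> of the Cauchy problem
  \<open>\<partial>\<^sub>t g = \<partial>\<^sub>v\<^sub>v g + 2 t \<partial>\<^sub>v\<^sub>z g + t\<^sup>2 \<partial>\<^sub>z\<^sub>z g\<close>, \<open>g(0, v, z) = f0(v, z)\<close>, namely the convolution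
  with the kernel for \<open>t > 0\<close>.
\<close>

definition kolmogorov_solution :: "(real \<times> real \<Rightarrow> real) \<Rightarrow> real \<Rightarrow> real \<times> real \<Rightarrow> real" where
  "kolmogorov_solution f0 t = (\<lambda>(v, z).
     if t = 0 then f0 (v, z)
     else (\<integral>(\<nu>, \<zeta>). kolmogorov_kernel t (\<nu>, \<zeta>) * f0 (v - \<nu>, z - \<zeta>) \<partial>lebesgue))"

text \<open>
  The solution of the self-similar equation
  \<open>\<partial>\<^sub>s h = 2 (1 - e\<^sup>-\<^sup>s) \<partial>\<^sub>v\<^sub>z h + \<partial>\<^sub>v\<^sub>v h + (1 - e\<^sup>-\<^sup>s)\<^sup>2 \<partial>\<^sub>z\<^sub>z h + v/2 \<partial>\<^sub>v h + 3z/2 \<partial>\<^sub>z h + 2 h\<close>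
  with datum \<open>h(0, v, z) = f0(v, z)\<close>, obtained from \<^const>\<open>kolmogorov_solution\<close> by
  the change of variables \<open>t = e\<^sup>s - 1\<close>.
\<close>

definition selfsimilar_solution :: "(real \<times> real \<Rightarrow> real) \<Rightarrow> real \<Rightarrow> real \<times> real \<Rightarrow> real" where
  "selfsimilar_solution f0 s = (\<lambda>(v, z).
     exp (2 * s) * kolmogorov_solution f0 (exp s - 1) (exp (s / 2) * v, exp (3 * s / 2) * z))"

end

theory Submission
  imports Defs "HOL-Probability.Distributions" "HOL-Real_Asymp.Real_Asymp"
begin

text \<open>
  Write \<open>G\<close> for the kernel at time one and \<open>t = exp s - 1\<close>.  The kernel has the scaling
  \<open>G\<^sub>t (v, z) = t\<^sup>-\<^sup>2 G (v / t^(1/2), z / t^(3/2))\<close>, so that in the self-similar variables the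
  solution becomes \<open>x \<mapsto> \<integral> K s x y f0 y dy\<close> with
  \<open>K s (v, z) (w, u) = a\<^sup>4 G (a v - b w, a\<^sup>3 z - b\<^sup>3 u)\<close>, where \<open>a = exp (s/2) / sqrt t\<close> tends to 1 and
  \<open>b = 1 / sqrt t\<close> tends to 0.  Hence \<open>K s x y\<close> converges to \<open>G x\<close> for all \<open>x\<close> and \<open>y\<close>: seen from
  far away the datum looks like a point mass of weight \<open>M0\<close> at the origin.  This pointwise convergence
  is upgraded to convergence of the error \<open>h s = \<integral> K s _ y f0 y dy - M0 G\<close> in three steps.

  \<^item> In \<open>L\<^sup>1\<close>.  Each \<open>K s _ y\<close> is a nonnegative function with the same mass as \<open>G\<close>, so that, as in
    Scheffe's lemma, \<open>\<integral> \<bar>K s x y - G x\<bar> dx\<close> is twice the integral of the positive part of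
    \<open>G x - K s x y\<close>.  That positive part is dominated by \<open>G x\<close>, and after multiplication with
    \<open>\<bar>f0 y\<bar>\<close> dominated convergence applies on the product space (lemma \<open>averaged_scheffe\<close>).
  \<^item> Uniformly.  \<open>G\<close> is Lipschitz, whence the functions \<open>h s\<close> are Lipschitz with a common constant for
    large \<open>s\<close>.  A function with a fixed Lipschitz constant that is large at one point has a large
    integral, hence \<open>L\<^sup>1\<close> convergence forces uniform convergence (lemma \<open>uniform_limit_of_L1_limit\<close>).
  \<^item> In \<open>L\<^sup>p\<close>.  As soon as \<open>\<bar>h s\<bar> \<le> 1\<close>, the integral of \<open>\<bar>h s\<bar> powr p\<close> is at most that of \<open>\<bar>h s\<bar>\<close>;
    for \<open>p = \<infinity>\<close> the uniform convergence is the claim (lemma \<open>Lp_norm_tendsto_zero\<close>).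
\<close>

section \<open>Averages of kernels of equal mass\<close>

text \<open>
  Pointwise convergence together with equality of masses gives convergence in mean, also after
  averaging over a parameter \<open>y\<close> with an integrable weight.  The reason is the identity
  \<open>\<bar>k - g\<bar> + g = 2 max 0 (g - k) + k\<close>: integrated, the terms \<open>g\<close> and \<open>k\<close> cancel, and the remaining
  positive part is at most \<open>g\<close>, which thus serves as a majorant for all \<open>s\<close> at once.
\<close>

lemma averaged_scheffe:
  fixes K :: "real \<Rightarrow> 'a::euclidean_space \<Rightarrow> 'b::euclidean_space \<Rightarrow> real"
  assumes G: "integrable lborel G" "\<And>x. 0 \<le> G x" and f: "integrable lborel f"
    and K [measurable]: "\<And>s. (\<lambda>(y, x). K s x y) \<in> borel_measurable (lborel \<Otimes>\<^sub>M lborel)"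
    and K_nonneg: "\<And>s x y. 0 \<le> K s x y"
    and mass: "\<forall>\<^sub>F s in at_top. \<forall>y. (\<integral>\<^sup>+x. K s x y \<partial>lborel) = (\<integral>\<^sup>+x. G x \<partial>lborel)"
    and lim: "\<And>x y. ((\<lambda>s. K s x y) \<longlongrightarrow> G x) at_top"
  shows "((\<lambda>s. \<integral>\<^sup>+x. \<integral>\<^sup>+y. ennreal (\<bar>K s x y - G x\<bar> * \<bar>f y\<bar>) \<partial>lborel \<partial>lborel) \<longlongrightarrow> 0) at_top"
proof -
  have [measurable]: "G \<in> borel_measurable borel" "f \<in> borel_measurable borel"
    using G(1) f by auto
  let ?P = "lborel \<Otimes>\<^sub>M lborel :: ('b \<times> 'a) measure"
  let ?pos = "\<lambda>s (y, x). max 0 (G x - K s x y) * \<bar>f y\<bar>"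
  have gf: "(\<integral>\<^sup>+(y, x). ennreal (G x * \<bar>f y\<bar>) \<partial>?P) = (\<integral>\<^sup>+x. G x \<partial>lborel) * (\<integral>\<^sup>+y. \<bar>f y\<bar> \<partial>lborel)"
    by (subst lborel.nn_integral_fst[symmetric])
       (simp_all add: ennreal_mult G nn_integral_multc nn_integral_cmult)
  have fin: "(\<integral>\<^sup>+(y, x). ennreal (G x * \<bar>f y\<bar>) \<partial>?P) < \<infinity>"
    unfolding gf using G f by (simp add: integrable_iff_bounded ennreal_mult_less_top)
  have dom: "integrable ?P (\<lambda>(y, x). G x * \<bar>f y\<bar>)"
    using fin G(2) by (intro integrableI_bounded) (auto simp: split_beta' abs_mult)
  have bound: "norm (?pos s w) \<le> (case w of (y, x) \<Rightarrow> G x * \<bar>f y\<bar>)" for s w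
    using K_nonneg[of s "snd w" "fst w"] G(2)[of "snd w"]
    by (auto simp: split_beta abs_mult intro!: mult_right_mono)
  have pos_int: "integrable ?P (?pos s)" for s
    by (rule Bochner_Integration.integrable_bound[OF dom]) (use bound in \<open>auto simp: G abs_mult split_beta\<close>)
  \<comment> \<open>Only the part of \<open>K s\<close> that lies below \<open>G\<close> enters here, hence the majorant.\<close>
  have "((\<lambda>s. \<integral>w. ?pos s w \<partial>?P) \<longlongrightarrow> (\<integral>w. 0 \<partial>?P)) at_top"
  proof (rule integral_dominated_convergence_at_top[OF _ _ dom])
    show "AE w in ?P. ((\<lambda>s. ?pos s w) \<longlongrightarrow> 0) at_top"
    proof (rule AE_I2, clarsimp)
      fix x y
      have "((\<lambda>s. max 0 (G x - K s x y) * \<bar>f y\<bar>) \<longlongrightarrow> max 0 (G x - G x) * \<bar>f y\<bar>) at_top"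
        by (intro tendsto_intros lim)
      then show "((\<lambda>s. max 0 (G x - K s x y) * \<bar>f y\<bar>) \<longlongrightarrow> 0) at_top" by simp
    qed
  qed (use bound in auto)
  then have "((\<lambda>s. 2 * ennreal (\<integral>w. ?pos s w \<partial>?P)) \<longlongrightarrow> 2 * ennreal 0) at_top"
    by (intro ennreal_tendsto_cmult tendsto_ennrealI) auto
  moreover have "\<forall>\<^sub>F s in at_top. 2 * ennreal (\<integral>w. ?pos s w \<partial>?P)
      = (\<integral>\<^sup>+x. \<integral>\<^sup>+y. ennreal (\<bar>K s x y - G x\<bar> * \<bar>f y\<bar>) \<partial>lborel \<partial>lborel)"
    using mass
  proof eventually_elim
    case (elim s)
    let ?A = "\<integral>\<^sup>+(y, x). ennreal (\<bar>K s x y - G x\<bar> * \<bar>f y\<bar>) \<partial>?P"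
    let ?B = "\<integral>\<^sup>+w. ennreal (?pos s w) \<partial>?P"
    let ?g = "\<integral>\<^sup>+(y, x). ennreal (G x * \<bar>f y\<bar>) \<partial>?P"
    have kf: "(\<integral>\<^sup>+(y, x). ennreal (K s x y * \<bar>f y\<bar>) \<partial>?P) = ?g"
      unfolding gf
      by (subst lborel.nn_integral_fst[symmetric])
         (simp_all add: ennreal_mult K_nonneg nn_integral_multc nn_integral_cmult elim)
    have "?A + ?g = (\<integral>\<^sup>+(y, x). ennreal (\<bar>K s x y - G x\<bar> * \<bar>f y\<bar>) + ennreal (G x * \<bar>f y\<bar>) \<partial>?P)"
      by (subst nn_integral_add[symmetric]) (auto simp: split_beta')
    also have "\<dots> = (\<integral>\<^sup>+w. 2 * ennreal (?pos s w) + ennreal (K s (snd w) (fst w) * \<bar>f (fst w)\<bar>) \<partial>?P)"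
    proof (rule nn_integral_cong, clarsimp)
      fix y x
      have "\<bar>K s x y - G x\<bar> * \<bar>f y\<bar> + G x * \<bar>f y\<bar> = 2 * (max 0 (G x - K s x y) * \<bar>f y\<bar>) + K s x y * \<bar>f y\<bar>"
        by (auto simp: max_def algebra_simps abs_if)
      then show "ennreal (\<bar>K s x y - G x\<bar> * \<bar>f y\<bar>) + ennreal (G x * \<bar>f y\<bar>)
          = 2 * ennreal (max 0 (G x - K s x y) * \<bar>f y\<bar>) + ennreal (K s x y * \<bar>f y\<bar>)"
        using G(2) K_nonneg
        by (subst ennreal_numeral[symmetric], subst ennreal_mult[symmetric])
           (auto simp flip: ennreal_plus)
    qed
    also have "\<dots> = 2 * ?B + ?g"
      using kf by (subst nn_integral_add) (auto simp: nn_integral_cmult split_beta')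
    finally have "?g + ?A = ?g + 2 * ?B"
      by (simp only: add.commute)
    then have "?g = \<infinity> \<or> ?A = 2 * ?B"
      by (simp only: ennreal_add_left_cancel)
    then have "?A = 2 * ?B"
      using fin by (metis less_irrefl)
    moreover have "?B = ennreal (\<integral>w. ?pos s w \<partial>?P)"
      by (intro nn_integral_eq_integral pos_int) auto
    moreover have "?A = (\<integral>\<^sup>+x. \<integral>\<^sup>+y. ennreal (\<bar>K s x y - G x\<bar> * \<bar>f y\<bar>) \<partial>lborel \<partial>lborel)"
      by (subst lborel_pair.nn_integral_snd[symmetric]) auto
    ultimately show ?case by simp
  qed
  ultimately show ?thesis
    by (simp add: filterlim_cong[OF refl refl] tendsto_cong)
qed

lemma kernel_average_L1_limit:
  fixes K :: "real \<Rightarrow> 'a::euclidean_space \<Rightarrow> 'b::euclidean_space \<Rightarrow> real"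
  assumes G: "integrable lborel G" "\<And>x. 0 \<le> G x" and f: "integrable lborel f"
    and K: "\<And>s. (\<lambda>(y, x). K s x y) \<in> borel_measurable (lborel \<Otimes>\<^sub>M lborel)"
    and K_nonneg: "\<And>s x y. 0 \<le> K s x y"
    and mass: "\<forall>\<^sub>F s in at_top. \<forall>y. (\<integral>\<^sup>+x. K s x y \<partial>lborel) = (\<integral>\<^sup>+x. G x \<partial>lborel)"
    and lim: "\<And>x y. ((\<lambda>s. K s x y) \<longlongrightarrow> G x) at_top"
    and Kf: "\<And>s x. integrable lborel (\<lambda>y. K s x y * f y)"
  shows "((\<lambda>s. \<integral>\<^sup>+x. \<bar>(\<integral>y. K s x y * f y \<partial>lborel) - (\<integral>y. f y \<partial>lborel) * G x\<bar> \<partial>lborel) \<longlongrightarrow> 0) at_top"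
proof (rule tendsto_sandwich[OF _ _ tendsto_const averaged_scheffe[OF assms(1-7)]])
  have "ennreal \<bar>(\<integral>y. K s x y * f y \<partial>lborel) - (\<integral>y. f y \<partial>lborel) * G x\<bar>
      \<le> (\<integral>\<^sup>+y. ennreal (\<bar>K s x y - G x\<bar> * \<bar>f y\<bar>) \<partial>lborel)" for s x
  proof -
    have "(\<integral>y. K s x y * f y \<partial>lborel) - (\<integral>y. f y \<partial>lborel) * G x
        = (\<integral>y. K s x y * f y \<partial>lborel) - (\<integral>y. G x * f y \<partial>lborel)"
      by (simp add: mult.commute)
    also have "\<dots> = (\<integral>y. (K s x y - G x) * f y \<partial>lborel)"
      using f Kf[of s x] by (subst Bochner_Integration.integral_diff[symmetric]) (auto simp: left_diff_distrib)
    finally have eq: "(\<integral>y. K s x y * f y \<partial>lborel) - (\<integral>y. f y \<partial>lborel) * G x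
        = (\<integral>y. (K s x y - G x) * f y \<partial>lborel)" .
    have "integrable lborel (\<lambda>y. (K s x y - G x) * f y)"
      using f Kf[of s x] by (auto simp: left_diff_distrib)
    from integral_norm_bound_ennreal[OF this] show ?thesis
      by (simp add: eq abs_mult)
  qed
  then show "\<forall>\<^sub>F s in at_top. (\<integral>\<^sup>+x. ennreal \<bar>(\<integral>y. K s x y * f y \<partial>lborel) - (\<integral>y. f y \<partial>lborel) * G x\<bar> \<partial>lborel)
      \<le> (\<integral>\<^sup>+x. \<integral>\<^sup>+y. ennreal (\<bar>K s x y - G x\<bar> * \<bar>f y\<bar>) \<partial>lborel \<partial>lborel)"
    by (intro always_eventually allI nn_integral_mono)
qed simp

text \<open>
  A Lipschitz constant of the kernel that is uniform in \<open>y\<close>, and also in a further parameter such as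
  time, passes to the averages; this makes the family of errors equicontinuous.
\<close>

lemma kernel_average_lipschitz:
  fixes f :: "'b::euclidean_space \<Rightarrow> real" and K :: "'a::metric_space \<Rightarrow> 'b \<Rightarrow> real"
  assumes f: "integrable lborel f" and Kf: "\<And>x. integrable lborel (\<lambda>y. K x y * f y)"
    and K: "\<And>x x' y. \<bar>K x y - K x' y\<bar> \<le> L * dist x x'" and L: "0 \<le> L"
  shows "(L * (\<integral>y. \<bar>f y\<bar> \<partial>lborel))-lipschitz_on UNIV (\<lambda>x. \<integral>y. K x y * f y \<partial>lborel)"
proof (rule lipschitz_onI)
  fix x x'
  have "dist (\<integral>y. K x y * f y \<partial>lborel) (\<integral>y. K x' y * f y \<partial>lborel)
      = \<bar>\<integral>y. (K x y - K x' y) * f y \<partial>lborel\<bar>"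
    using Kf by (simp add: dist_real_def left_diff_distrib)
  also have "\<dots> \<le> (\<integral>y. \<bar>(K x y - K x' y) * f y\<bar> \<partial>lborel)"
    by (rule integral_abs_bound)
  also have "\<dots> \<le> (\<integral>y. L * dist x x' * \<bar>f y\<bar> \<partial>lborel)"
  proof (rule integral_mono)
    show "integrable lborel (\<lambda>y. \<bar>(K x y - K x' y) * f y\<bar>)"
      unfolding left_diff_distrib by (intro integrable_abs Bochner_Integration.integrable_diff Kf)
    show "integrable lborel (\<lambda>y. L * dist x x' * \<bar>f y\<bar>)"
      using f by (intro integrable_mult_right integrable_abs)
    show "\<bar>(K x y - K x' y) * f y\<bar> \<le> L * dist x x' * \<bar>f y\<bar>" for y
      unfolding abs_mult by (intro mult_right_mono K) simp
  qed
  also have "\<dots> = L * (\<integral>y. \<bar>f y\<bar> \<partial>lborel) * dist x x'" by simp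
  finally show "dist (\<integral>y. K x y * f y \<partial>lborel) (\<integral>y. K x' y * f y \<partial>lborel)
      \<le> L * (\<integral>y. \<bar>f y\<bar> \<partial>lborel) * dist x x'" .
qed (use L in simp)

section \<open>From convergence in mean to uniform and Lp convergence\<close>

text \<open>
  On the ball of radius \<open>\<eta> / (2 C)\<close> around \<open>x\<close> the function cannot drop below \<open>\<eta> / 2\<close>.
\<close>

lemma lipschitz_L1_lower_bound:
  fixes h :: "'a::euclidean_space \<Rightarrow> real"
  assumes lip: "C-lipschitz_on UNIV h" and C: "0 < C" and eta: "0 \<le> \<eta>" "\<eta> \<le> \<bar>h x\<bar>"
  shows "ennreal (\<eta> / 2 * (unit_ball_vol DIM('a) * (\<eta> / (2 * C)) ^ DIM('a))) \<le> (\<integral>\<^sup>+u. \<bar>h u\<bar> \<partial>lborel)"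
proof -
  let ?B = "ball x (\<eta> / (2 * C))"
  have low: "\<eta> / 2 \<le> \<bar>h u\<bar>" if "u \<in> ?B" for u
  proof -
    have "\<bar>h x - h u\<bar> \<le> C * dist x u"
      using lipschitz_onD[OF lip, of x u] by (simp add: dist_real_def)
    also have "\<dots> \<le> \<eta> / 2"
      using that C by (simp add: field_simps)
    finally show ?thesis using eta by linarith
  qed
  have "ennreal (\<eta> / 2 * (unit_ball_vol DIM('a) * (\<eta> / (2 * C)) ^ DIM('a))) = (\<integral>\<^sup>+u. ennreal (\<eta> / 2) * indicator ?B u \<partial>lborel)"
    using eta C by (subst ennreal_mult) (simp_all add: nn_integral_cmult_indicator emeasure_ball)
  also have "\<dots> \<le> (\<integral>\<^sup>+u. \<bar>h u\<bar> \<partial>lborel)"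
    using low by (intro nn_integral_mono) (auto simp: indicator_def intro!: ennreal_leI)
  finally show ?thesis .
qed

lemma uniform_limit_of_L1_limit:
  fixes h :: "'s \<Rightarrow> 'a::euclidean_space \<Rightarrow> real"
  assumes lip: "\<forall>\<^sub>F s in F. C-lipschitz_on UNIV (h s)" and C: "0 < C"
    and L1: "((\<lambda>s. \<integral>\<^sup>+u. \<bar>h s u\<bar> \<partial>lborel) \<longlongrightarrow> 0) F" and e: "0 < e"
  shows "\<forall>\<^sub>F s in F. \<forall>x. \<bar>h s x\<bar> < e"
proof -
  have "0 < ennreal (e / 2 * (unit_ball_vol DIM('a) * (e / (2 * C)) ^ DIM('a)))"
    using e C by (simp add: unit_ball_vol_pos)
  from order_tendstoD(2)[OF L1 this] lip show ?thesis
  proof eventually_elim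
    case (elim s)
    show ?case
    proof (rule allI, rule ccontr)
      fix x assume "\<not> \<bar>h s x\<bar> < e"
      then show False
        using lipschitz_L1_lower_bound[OF elim(2) C, of e x] e elim(1) by (auto simp: not_less)
    qed
  qed
qed

lemma Lp_space_1_integrable:
  assumes "f \<in> Lp_space M 1"
  shows "integrable M f"
proof (rule integrableI_bounded)
  show "f \<in> borel_measurable M" using assms by (simp add: Lp_space_def)
  then show "(\<integral>\<^sup>+x. ennreal (norm (f x)) \<partial>M) < \<infinity>"
    using assms by (auto simp: Lp_space_def Lp_norm_def Let_def top.not_eq_extremum split: if_splits)
qed

lemma Lp_norm_tendsto_zero:
  fixes h :: "'s \<Rightarrow> 'a::euclidean_space \<Rightarrow> real"
  assumes p: "1 \<le> p"
    and meas: "\<forall>\<^sub>F s in F. h s \<in> borel_measurable borel"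
    and L1: "((\<lambda>s. \<integral>\<^sup>+u. \<bar>h s u\<bar> \<partial>lborel) \<longlongrightarrow> 0) F"
    and unif: "\<And>e. 0 < e \<Longrightarrow> \<forall>\<^sub>F s in F. \<forall>x. \<bar>h s x\<bar> < e"
  shows "((\<lambda>s. Lp_norm lebesgue p (h s)) \<longlongrightarrow> 0) F"
proof (cases "p = \<infinity>")
  case True
  show ?thesis
  proof (rule order_tendstoI)
    fix e :: ennreal assume "0 < e"
    then obtain r :: real where r: "0 < r" "ennreal r < e"
      by (cases e) (auto intro: that[of 1] that[of "enn2real e / 2"] simp: ennreal_less_iff)
    show "\<forall>\<^sub>F s in F. Lp_norm lebesgue p (h s) < e"
      using unif[OF r(1)] meas
    proof eventually_elim
      case (elim s)
      have m: "h s \<in> borel_measurable lebesgue"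
        using elim(2) by (simp add: measurable_completion)
      have "esssup lebesgue (\<lambda>x. ennreal \<bar>h s x\<bar>) \<le> ennreal r"
        using elim(1) m by (intro esssup_I AE_I2 ennreal_leI) (auto simp: less_imp_le)
      then show ?case
        using r m True by (simp add: Lp_norm_def)
    qed
  qed auto
next
  case False
  define q where "q = enn2real p"
  have q: "1 \<le> q"
    using p False unfolding q_def by (cases p) (auto simp: ennreal_le_iff2 top_ennreal_def)
  let ?J = "\<lambda>s. \<integral>\<^sup>+u. \<bar>h s u\<bar> \<partial>lborel"
  have "((\<lambda>s. enn2real (?J s)) \<longlongrightarrow> enn2real 0) F"
    using L1 by (intro tendsto_enn2real) (auto simp flip: zero_ennreal_def ennreal_0)
  then have "((\<lambda>s. enn2real (?J s) powr (1 / q)) \<longlongrightarrow> 0) F"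
    using q by (intro tendsto_zero_powrI[where b = "1 / q"]) auto
  then have lim: "((\<lambda>s. ennreal (enn2real (?J s) powr (1 / q))) \<longlongrightarrow> 0) F"
    using tendsto_ennrealI by fastforce
  have J1: "\<forall>\<^sub>F s in F. ?J s < 1"
    using order_tendstoD(2)[OF L1, of 1] by simp
  have "\<forall>\<^sub>F s in F. Lp_norm lebesgue p (h s) \<le> ennreal (enn2real (?J s) powr (1 / q))"
    using unif[OF zero_less_one] meas J1
  proof eventually_elim
    case (elim s)
    let ?I = "\<integral>\<^sup>+x. ennreal (\<bar>h s x\<bar> powr q) \<partial>lebesgue"
    have m: "h s \<in> borel_measurable lebesgue"
      using elim(2) by (simp add: measurable_completion)
    \<comment> \<open>Raising a number in \<open>[0, 1]\<close> to a power \<open>q \<ge> 1\<close> does not increase it, so \<open>?J\<close> controls all powers.\<close>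
    have "\<bar>h s x\<bar> powr q \<le> \<bar>h s x\<bar>" for x
      using powr_mono'[of 1 q "\<bar>h s x\<bar>"] elim(1) q by (auto simp: less_imp_le)
    then have IJ: "?I \<le> ?J s"
      by (simp add: nn_integral_completion) (intro nn_integral_mono ennreal_leI)
    then have fin: "?I < \<infinity>"
      using elim(3) by (metis ennreal_one_less_top infinity_ennreal_def order_le_less_trans order_less_trans)
    have "enn2real ?I \<le> enn2real (?J s)"
      using IJ elim(3) by (intro enn2real_mono) (auto intro: order_less_trans)
    then have "enn2real ?I powr (1 / q) \<le> enn2real (?J s) powr (1 / q)"
      using q by (intro powr_mono2) auto
    then show ?case
      using m fin False by (auto simp: Lp_norm_def Let_def q_def intro!: ennreal_leI)
  qed
  then show ?thesis
    by (intro tendsto_sandwich[OF _ _ tendsto_const lim]) auto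
qed

section \<open>Changes of variables\<close>

lemma distr_lborel_reflect: "distr lborel borel (\<lambda>w. X - w) = (lborel :: 'a::euclidean_space measure)"
  using lborel_affine[of "-1" X] by (simp add: density_1)

text \<open>
  Joint measurability in \<open>(y, x)\<close>, on which Fubini's theorem rests, comes from Borel measurability,
  whereas a datum in a Lebesgue space is only Lebesgue measurable.  A convolution does not see the replacement of the datum by an
  almost everywhere equal Borel function, because reflections and translations leave null sets null.
\<close>

lemma lebesgue_convolution_eq_lborel:
  fixes f f' k :: "'a::euclidean_space \<Rightarrow> real"
  assumes f: "f \<in> borel_measurable lebesgue" and [measurable]: "f' \<in> borel_measurable borel"
    and ae: "AE y in lborel. f y = f' y" and [measurable]: "k \<in> borel_measurable borel"
  shows "(\<integral>w. k w * f (X - w) \<partial>lebesgue) = (\<integral>y. k (X - y) * f' y \<partial>lborel)"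
proof -
  have "(\<lambda>w. X + (\<Sum>j\<in>Basis. (- 1 * (w \<bullet> j)) *\<^sub>R j)) \<in> lebesgue \<rightarrow>\<^sub>M lebesgue"
    by (rule lebesgue_affine_measurable) simp
  then have "(\<lambda>w. X - w) \<in> lebesgue \<rightarrow>\<^sub>M lebesgue"
    by (simp add: sum_negf euclidean_representation)
  then have f_refl: "(\<lambda>w. f (X - w)) \<in> borel_measurable lebesgue"
    using f by (rule measurable_compose)
  \<comment> \<open>The set where \<open>f\<close> and \<open>f'\<close> differ need not be Borel, so a Borel null set containing it is reflected.\<close>
  obtain N where N: "N \<in> null_sets lborel" "{y. f y \<noteq> f' y} \<subseteq> N"
    using ae by (auto simp: eventually_ae_filter)
  then have [measurable]: "N \<in> sets borel" by auto
  have "AE y in distr lborel borel (\<lambda>w. X - w). y \<notin> N"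
    unfolding distr_lborel_reflect using N(1) by (rule AE_not_in)
  then have "AE w in lborel. X - w \<notin> N"
    by (subst (asm) AE_distr_iff) auto
  then have "AE w in lborel. f (X - w) = f' (X - w)"
    by (rule eventually_mono) (use N(2) in auto)
  then have "AE w in lebesgue. k w * f (X - w) = k w * f' (X - w)"
    by (intro AE_completion) (auto elim: eventually_mono)
  then have "(\<integral>w. k w * f (X - w) \<partial>lebesgue) = (\<integral>w. k w * f' (X - w) \<partial>lebesgue)"
  proof (rule integral_cong_AE[rotated -1])
    show "(\<lambda>w. k w * f (X - w)) \<in> borel_measurable lebesgue"
      by (intro borel_measurable_times f_refl measurable_completion) auto
    show "(\<lambda>w. k w * f' (X - w)) \<in> borel_measurable lebesgue"
      by (intro measurable_completion) auto
  qed
  also have "\<dots> = (\<integral>w. k w * f' (X - w) \<partial>lborel)"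
    by (intro integral_completion) auto
  also have "\<dots> = (\<integral>y. k (X - y) * f' y \<partial>distr lborel borel (\<lambda>w. X - w))"
    by (subst integral_distr) auto
  also have "\<dots> = (\<integral>y. k (X - y) * f' y \<partial>lborel)"
    by (simp add: distr_lborel_reflect)
  finally show ?thesis .
qed

lemma nn_integral_lborel_dilate:
  fixes F :: "real \<times> real \<Rightarrow> ennreal"
  assumes [measurable]: "F \<in> borel_measurable borel" and "0 < \<alpha>" "0 < \<beta>"
  shows "(\<integral>\<^sup>+x. F x \<partial>lborel) = ennreal (\<alpha> * \<beta>) * (\<integral>\<^sup>+x. F (\<alpha> * fst x - c, \<beta> * snd x - d) \<partial>lborel)"
proof -
  have [measurable]: "F \<in> borel_measurable (borel \<Otimes>\<^sub>M borel)"
    by (simp add: borel_prod)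
  have "(\<integral>\<^sup>+x. F x \<partial>lborel) = (\<integral>\<^sup>+v. \<integral>\<^sup>+z. F (v, z) \<partial>lborel \<partial>lborel)"
    by (subst lborel.nn_integral_fst) (auto simp: lborel_prod)
  also have "\<dots> = (\<integral>\<^sup>+v. ennreal \<beta> * (\<integral>\<^sup>+z. F (v, \<beta> * z - d) \<partial>lborel) \<partial>lborel)"
    using assms(3) by (intro nn_integral_cong, subst nn_integral_real_affine[where c=\<beta> and t="- d"]) auto
  also have "\<dots> = ennreal \<alpha> * (\<integral>\<^sup>+v. ennreal \<beta> * (\<integral>\<^sup>+z. F (\<alpha> * v - c, \<beta> * z - d) \<partial>lborel) \<partial>lborel)"
    using assms(2) by (subst nn_integral_real_affine[where c=\<alpha> and t="- c"]) auto
  also have "\<dots> = ennreal (\<alpha> * \<beta>) * (\<integral>\<^sup>+v. \<integral>\<^sup>+z. F (\<alpha> * v - c, \<beta> * z - d) \<partial>lborel \<partial>lborel)"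
    using assms by (simp add: nn_integral_cmult ennreal_mult mult.assoc)
  also have "(\<integral>\<^sup>+v. \<integral>\<^sup>+z. F (\<alpha> * v - c, \<beta> * z - d) \<partial>lborel \<partial>lborel)
      = (\<integral>\<^sup>+x. F (\<alpha> * fst x - c, \<beta> * snd x - d) \<partial>(lborel \<Otimes>\<^sub>M lborel))"
    by (subst lborel.nn_integral_fst[symmetric]) auto
  finally show ?thesis by (simp add: lborel_prod)
qed

section \<open>The kernel at time one\<close>

text \<open>
  The derivative \<open>- 2 r exp (- r\<^sup>2)\<close> has absolute value at most 1, as \<open>2 \<bar>r\<bar> \<le> 1 + r\<^sup>2 \<le> exp (r\<^sup>2)\<close>.
\<close>

lemma gaussian_lipschitz: "\<bar>exp (- r\<^sup>2) - exp (- s\<^sup>2)\<bar> \<le> \<bar>r - s\<bar>" for r s :: real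
proof -
  have bd: "norm (- (2 * x) * exp (- x\<^sup>2)) \<le> 1" for x :: real
  proof -
    have "2 * \<bar>x\<bar> \<le> 1 + x\<^sup>2"
      using zero_le_power2[of "\<bar>x\<bar> - 1"] by (simp add: power2_diff)
    also have "\<dots> \<le> exp (x\<^sup>2)" by (rule exp_ge_add_one_self)
    finally show ?thesis by (simp add: abs_mult exp_minus field_simps)
  qed
  have "norm (exp (- r\<^sup>2) - exp (- s\<^sup>2)) \<le> 1 * norm (r - s)"
    by (rule field_differentiable_bound[of UNIV _ "\<lambda>x. - (2 * x) * exp (- x\<^sup>2)"])
       (use bd in \<open>auto intro!: derivative_eq_intros\<close>)
  then show ?thesis by simp
qed

lemma abs_diff_mult_le:
  fixes p q p' q' :: real
  assumes "0 \<le> p'" "p' \<le> 1" "0 \<le> q" "q \<le> 1"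
  shows "\<bar>p * q - p' * q'\<bar> \<le> \<bar>p - p'\<bar> + \<bar>q - q'\<bar>"
proof -
  have "\<bar>p * q - p' * q'\<bar> = \<bar>(p - p') * q + p' * (q - q')\<bar>"
    by (simp add: algebra_simps)
  also have "\<dots> \<le> \<bar>p - p'\<bar> * q + p' * \<bar>q - q'\<bar>"
    using assms by (intro order_trans[OF abs_triangle_ineq]) (simp add: abs_mult)
  also have "\<dots> \<le> \<bar>p - p'\<bar> * 1 + 1 * \<bar>q - q'\<bar>"
    using assms by (intro add_mono mult_left_mono mult_right_mono) auto
  finally show ?thesis by simp
qed

text \<open>
  Completing the square separates the kernel into two one-dimensional Gaussians, in \<open>z\<close> and in the
  sheared variable \<open>v - 3 z / 2\<close>; integrability and Lipschitz continuity are read off from this form.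
\<close>

lemma kernel_one_eq:
  "kolmogorov_kernel 1 (v, z)
     = sqrt 3 / (2 * pi) * (exp (- (sqrt 3 / 2 * z)\<^sup>2) * exp (- (v - 3 / 2 * z)\<^sup>2))"
proof -
  have "- (1 / 4) * (3 * z\<^sup>2 + (2 * v - 3 * z)\<^sup>2) = - (sqrt 3 / 2 * z)\<^sup>2 + - (v - 3 / 2 * z)\<^sup>2"
    by (simp add: power_mult_distrib power2_diff power_divide algebra_simps)
  then show ?thesis
    by (simp add: kolmogorov_kernel_def flip: exp_add)
qed

lemma kernel_const: "0 < sqrt 3 / (2 * pi)" "sqrt 3 / (2 * pi) \<le> (1::real)"
proof -
  have "sqrt 3 \<le> 2" by (rule real_le_lsqrt) auto
  then show "sqrt 3 / (2 * pi) \<le> (1::real)" using pi_gt3 by (simp add: divide_le_eq)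
qed simp

lemma kernel_one_nonneg: "0 \<le> kolmogorov_kernel 1 x"
  by (cases x) (simp add: kernel_one_eq)

lemma kernel_one_le_1: "kolmogorov_kernel 1 x \<le> 1"
  using kernel_const by (cases x) (simp add: kernel_one_eq mult_le_one del: times_divide_eq_left)

lemma kernel_one_lipschitz: "4-lipschitz_on UNIV (kolmogorov_kernel 1)"
proof (rule lipschitz_onI)
  fix x y :: "real \<times> real"
  obtain v z w u where xy: "x = (v, z)" "y = (w, u)" by (metis surj_pair)
  let ?P = "\<lambda>z::real. exp (- (sqrt 3 / 2 * z)\<^sup>2)" and ?Q = "\<lambda>v z::real. exp (- (v - 3 / 2 * z)\<^sup>2)"
  have s3: "sqrt 3 \<le> 2" by (rule real_le_lsqrt) auto
  have dv: "\<bar>v - w\<bar> \<le> dist x y" and dz: "\<bar>z - u\<bar> \<le> dist x y"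
    using dist_fst_le[of x y] dist_snd_le[of x y] by (simp_all add: xy dist_real_def)
  have "\<bar>?P z - ?P u\<bar> \<le> \<bar>sqrt 3 / 2 * z - sqrt 3 / 2 * u\<bar>" by (rule gaussian_lipschitz)
  also have "\<dots> = sqrt 3 / 2 * \<bar>z - u\<bar>"
    unfolding right_diff_distrib[symmetric] abs_mult by simp
  also have "\<dots> \<le> 1 * \<bar>z - u\<bar>" using s3 by (intro mult_right_mono) auto
  finally have P: "\<bar>?P z - ?P u\<bar> \<le> dist x y" using dz by simp
  have "\<bar>?Q v z - ?Q w u\<bar> \<le> \<bar>(v - 3 / 2 * z) - (w - 3 / 2 * u)\<bar>" by (rule gaussian_lipschitz)
  also have "\<dots> \<le> \<bar>v - w\<bar> + 3 / 2 * \<bar>z - u\<bar>"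
  proof -
    have "(v - 3 / 2 * z) - (w - 3 / 2 * u) = (v - w) - 3 / 2 * (z - u)" by (simp add: field_simps)
    then show ?thesis
      using abs_triangle_ineq4[of "v - w" "3 / 2 * (z - u)"] by (simp only: abs_mult)
  qed
  also have "\<dots> \<le> dist x y + 3 / 2 * dist x y"
    using dv dz by (intro add_mono mult_left_mono) simp_all
  also have "\<dots> \<le> 3 * dist x y"
    using zero_le_dist[of x y] by linarith
  finally have Q: "\<bar>?Q v z - ?Q w u\<bar> \<le> 3 * dist x y" .
  have PQ: "\<bar>?P z * ?Q v z - ?P u * ?Q w u\<bar> \<le> 4 * dist x y"
  proof -
    have "\<bar>?P z * ?Q v z - ?P u * ?Q w u\<bar> \<le> \<bar>?P z - ?P u\<bar> + \<bar>?Q v z - ?Q w u\<bar>"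
      by (rule abs_diff_mult_le) simp_all
    also have "\<dots> \<le> dist x y + 3 * dist x y"
      using P Q by (rule add_mono)
    finally show ?thesis by simp
  qed
  have "dist (kolmogorov_kernel 1 x) (kolmogorov_kernel 1 y)
      = sqrt 3 / (2 * pi) * \<bar>?P z * ?Q v z - ?P u * ?Q w u\<bar>"
    unfolding xy kernel_one_eq dist_real_def right_diff_distrib[symmetric] abs_mult
      abs_of_pos[OF kernel_const(1)] ..
  also have "\<dots> \<le> 1 * (4 * dist x y)"
    using kernel_const PQ by (intro mult_mono) simp_all
  finally show "dist (kolmogorov_kernel 1 x) (kolmogorov_kernel 1 y) \<le> 4 * dist x y" by simp
qed simp

lemma kernel_borel_measurable [measurable]: "kolmogorov_kernel t \<in> borel_measurable borel"
  unfolding kolmogorov_kernel_def split_beta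
  by (intro borel_measurable_continuous_onI continuous_intros)

lemma nn_integral_gaussian_finite: "(\<integral>\<^sup>+r. ennreal (exp (- r\<^sup>2)) \<partial>lborel) < \<infinity>"
proof -
  have "integrable lborel (\<lambda>r::real. sqrt pi * normal_density 0 (1 / sqrt 2) r)"
    by (intro integrable_mult_right integrable_normal_density) simp
  also have "(\<lambda>r::real. sqrt pi * normal_density 0 (1 / sqrt 2) r) = (\<lambda>r. exp (- r\<^sup>2))"
    by (auto simp: normal_density_def power_divide)
  finally show ?thesis by (simp add: integrable_iff_bounded)
qed

lemma kernel_one_integrable: "integrable lborel (kolmogorov_kernel 1)"
proof -
  let ?I = "\<integral>\<^sup>+r. ennreal (exp (- (r::real)\<^sup>2)) \<partial>lborel"
  have [measurable]: "kolmogorov_kernel 1 \<in> borel_measurable (borel \<Otimes>\<^sub>M borel)"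
    by (simp add: borel_prod)
  have "(\<integral>\<^sup>+x. ennreal (kolmogorov_kernel 1 x) \<partial>lborel)
      = (\<integral>\<^sup>+z. \<integral>\<^sup>+v. ennreal (kolmogorov_kernel 1 (v, z)) \<partial>lborel \<partial>lborel)"
    by (subst lborel_pair.nn_integral_snd) (auto simp: lborel_prod)
  also have "\<dots> \<le> (\<integral>\<^sup>+z. \<integral>\<^sup>+v. ennreal (exp (- (sqrt 3 / 2 * z)\<^sup>2)) * ennreal (exp (- (v - 3 / 2 * z)\<^sup>2)) \<partial>lborel \<partial>lborel)"
    using kernel_const
    by (intro nn_integral_mono) (simp add: kernel_one_eq mult_left_le_one_le flip: ennreal_mult del: times_divide_eq_left)
  also have "\<dots> = (\<integral>\<^sup>+z. ennreal (exp (- (sqrt 3 / 2 * z)\<^sup>2)) * ?I \<partial>lborel)"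
    by (intro nn_integral_cong, subst nn_integral_cmult, simp, subst (2) nn_integral_real_affine[where c=1 and t="- (3 / 2 * _)"])
       auto
  also have "\<dots> = (\<integral>\<^sup>+z. ennreal (exp (- (sqrt 3 / 2 * z)\<^sup>2)) \<partial>lborel) * ?I"
    by (intro nn_integral_multc) auto
  also have "\<dots> < \<infinity>"
  proof -
    have "?I = ennreal (sqrt 3 / 2) * (\<integral>\<^sup>+z. ennreal (exp (- (sqrt 3 / 2 * z)\<^sup>2)) \<partial>lborel)"
      by (subst nn_integral_real_affine[where c="sqrt 3 / 2" and t=0]) auto
    then have "(\<integral>\<^sup>+z. ennreal (exp (- (sqrt 3 / 2 * z)\<^sup>2)) \<partial>lborel) < \<infinity>"
      using nn_integral_gaussian_finite by (auto simp: ennreal_mult_less_top)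
    then show ?thesis using nn_integral_gaussian_finite by (simp add: ennreal_mult_less_top)
  qed
  finally show ?thesis
    by (intro integrableI_bounded) (auto simp: kernel_one_nonneg)
qed

section \<open>Anisotropic dilations\<close>

text \<open>
  The exponents reflect the scaling of the Kolmogorov equation, in which \<open>z\<close> has the size of \<open>v\<^sup>3\<close>;
  the factor \<open>a\<^sup>4 = a a\<^sup>3\<close> is the Jacobian of the dilation of \<open>x\<close>, so that mass is preserved.
\<close>

definition dilated_kernel :: "(real \<times> real \<Rightarrow> real) \<Rightarrow> real \<Rightarrow> real \<Rightarrow> real \<times> real \<Rightarrow> real \<times> real \<Rightarrow> real" where
  "dilated_kernel G a b x y = a ^ 4 * G (a * fst x - b * fst y, a ^ 3 * snd x - b ^ 3 * snd y)"

lemma dilated_kernel_mass: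
  assumes [measurable]: "G \<in> borel_measurable borel" and G: "\<And>x. 0 \<le> G x" and a: "0 < a"
  shows "(\<integral>\<^sup>+x. dilated_kernel G a b x y \<partial>lborel) = (\<integral>\<^sup>+x. G x \<partial>lborel)"
proof -
  have [measurable]: "G \<in> borel_measurable (borel \<Otimes>\<^sub>M borel)"
    by (simp add: borel_prod)
  have "(\<integral>\<^sup>+x. G x \<partial>lborel) = ennreal (a * a ^ 3) *
      (\<integral>\<^sup>+x. ennreal (G (a * fst x - b * fst y, a ^ 3 * snd x - b ^ 3 * snd y)) \<partial>lborel)"
    using a by (intro nn_integral_lborel_dilate) auto
  also have "\<dots> = (\<integral>\<^sup>+x. dilated_kernel G a b x y \<partial>lborel)"
    using a G by (subst nn_integral_cmult[symmetric])
      (auto simp: dilated_kernel_def ennreal_mult eval_nat_numeral borel_prod[symmetric])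
  finally show ?thesis by simp
qed

lemma dilated_kernel_measurable:
  assumes "G \<in> borel_measurable borel"
  shows "(\<lambda>(y, x). dilated_kernel G a b x y) \<in> borel_measurable (lborel \<Otimes>\<^sub>M lborel)"
proof -
  have "(\<lambda>w::(real \<times> real) \<times> (real \<times> real).
      (a * fst (snd w) - b * fst (fst w), a ^ 3 * snd (snd w) - b ^ 3 * snd (fst w))) \<in> borel_measurable borel"
    by (intro borel_measurable_continuous_onI continuous_intros)
  from measurable_compose[OF this assms] show ?thesis
    by (simp add: dilated_kernel_def split_beta' lborel_prod)
qed

lemma dilated_kernel_integrable:
  assumes [measurable]: "G \<in> borel_measurable borel" and G: "\<And>x. \<bar>G x\<bar> \<le> B" and f: "integrable lborel f"
  shows "integrable lborel (\<lambda>y. dilated_kernel G a b x y * f y)"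
proof (rule Bochner_Integration.integrable_bound)
  show "integrable lborel (\<lambda>y. a ^ 4 * B * f y)"
    using f by simp
  have [measurable]: "f \<in> borel_measurable borel" using f by auto
  show "(\<lambda>y. dilated_kernel G a b x y * f y) \<in> borel_measurable lborel"
  proof (intro borel_measurable_times)
    have "(\<lambda>y::real \<times> real. (a * fst x - b * fst y, a ^ 3 * snd x - b ^ 3 * snd y)) \<in> borel_measurable borel"
      by (intro borel_measurable_continuous_onI continuous_intros)
    from measurable_compose[OF this assms(1)] show "dilated_kernel G a b x \<in> borel_measurable lborel"
      by (simp add: dilated_kernel_def[abs_def])
  qed simp
  have "0 \<le> B" using G[of undefined] by linarith
  have "\<bar>dilated_kernel G a b x y\<bar> \<le> a ^ 4 * B" for y
    using G by (auto simp: dilated_kernel_def abs_mult intro!: mult_left_mono)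
  then show "AE y in lborel. norm (dilated_kernel G a b x y * f y) \<le> norm (a ^ 4 * B * f y)"
    using \<open>0 \<le> B\<close> by (auto simp: abs_mult intro!: mult_right_mono)
qed

text \<open>
  The bound \<open>a \<le> 2\<close> serves to have a constant independent of \<open>a\<close>; the argument of \<open>G\<close> moves by at most
  \<open>2\<^sup>3 dist x x'\<close>, and the prefactor is at most \<open>2\<^sup>4\<close>.
\<close>

lemma dilated_kernel_lipschitz:
  assumes G: "L-lipschitz_on UNIV G" and a: "0 < a" "a \<le> 2"
  shows "\<bar>dilated_kernel G a b x y - dilated_kernel G a b x' y\<bar> \<le> 128 * L * dist x x'"
proof -
  let ?p = "\<lambda>x. (a * fst x - b * fst y, a ^ 3 * snd x - b ^ 3 * snd y)"
  have L: "0 \<le> L" using G by (rule lipschitz_on_nonneg)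
  have a3: "a ^ 3 \<le> 8" and a4: "a ^ 4 \<le> 16"
    using power_mono[OF a(2), of 3] power_mono[OF a(2), of 4] a by auto
  have "dist (?p x) (?p x') = sqrt ((a * dist (fst x) (fst x'))\<^sup>2 + (a ^ 3 * dist (snd x) (snd x'))\<^sup>2)"
    using a by (simp add: dist_Pair_Pair dist_real_def power_mult_distrib flip: right_diff_distrib)
  also have "\<dots> \<le> sqrt ((8 * dist (fst x) (fst x'))\<^sup>2 + (8 * dist (snd x) (snd x'))\<^sup>2)"
    using a a3 by (intro real_sqrt_le_mono add_mono power_mono mult_right_mono) auto
  also have "\<dots> = 8 * dist x x'"
    unfolding power_mult_distrib distrib_left[symmetric] real_sqrt_mult dist_prod_def by simp
  finally have p: "dist (?p x) (?p x') \<le> 8 * dist x x'" .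
  have "\<bar>dilated_kernel G a b x y - dilated_kernel G a b x' y\<bar> = a ^ 4 * dist (G (?p x)) (G (?p x'))"
    using a by (simp add: dilated_kernel_def dist_real_def abs_mult flip: right_diff_distrib)
  also have "\<dots> \<le> 16 * (L * (8 * dist x x'))"
    using a a4 L p by (intro mult_mono order_trans[OF lipschitz_onD[OF G]] mult_left_mono) auto
  finally show ?thesis by simp
qed

lemma dilated_kernel_tendsto:
  assumes G: "continuous_on UNIV G" and "(a \<longlongrightarrow> 1) F" "(b \<longlongrightarrow> 0) F"
  shows "((\<lambda>s. dilated_kernel G (a s) (b s) x y) \<longlongrightarrow> G x) F"
proof -
  have "((\<lambda>s. (a s * fst x - b s * fst y, a s ^ 3 * snd x - b s ^ 3 * snd y)) \<longlongrightarrow>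
      (1 * fst x - 0 * fst y, 1 ^ 3 * snd x - 0 ^ 3 * snd y)) F"
    by (intro tendsto_intros assms)
  then have "((\<lambda>s. (a s * fst x - b s * fst y, a s ^ 3 * snd x - b s ^ 3 * snd y)) \<longlongrightarrow> x) F"
    by simp
  moreover have "isCont G x"
    using continuous_on_eq_continuous_at[OF open_UNIV, of G] G by blast
  ultimately have "((\<lambda>s. G (a s * fst x - b s * fst y, a s ^ 3 * snd x - b s ^ 3 * snd y)) \<longlongrightarrow> G x) F"
    by (rule isCont_tendsto_compose[rotated])
  from tendsto_mult[OF tendsto_power[OF assms(2), of 4] this] show ?thesis
    by (simp add: dilated_kernel_def)
qed

section \<open>The solution in self-similar variables\<close>

definition space_scale :: "real \<Rightarrow> real" where "space_scale s = exp (s / 2) / sqrt (exp s - 1)"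

definition datum_scale :: "real \<Rightarrow> real" where "datum_scale s = 1 / sqrt (exp s - 1)"

lemma space_scale_tendsto: "(space_scale \<longlongrightarrow> 1) at_top"
  unfolding space_scale_def[abs_def] by real_asymp

lemma datum_scale_tendsto: "(datum_scale \<longlongrightarrow> 0) at_top"
  unfolding datum_scale_def[abs_def] by real_asymp

text \<open>
  With \<open>r = sqrt t\<close> and \<open>e = exp (s / 2)\<close> the self-similar change of variables divides \<open>e v - w\<close> by \<open>r\<close>
  and \<open>e\<^sup>3 z - u\<close> by \<open>r\<^sup>3\<close>, and the prefactors combine to \<open>(e / r)\<^sup>4\<close>.
\<close>

lemma rescaled_kernel_eq:
  assumes s: "0 < s"
  shows "exp (2 * s) * kolmogorov_kernel (exp s - 1) (exp (s / 2) * v - w, exp (3 * s / 2) * z - u)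
    = dilated_kernel (kolmogorov_kernel 1) (space_scale s) (datum_scale s) (v, z) (w, u)"
proof -
  define r where "r = sqrt (exp s - 1)"
  define e where "e = exp (s / 2)"
  have r: "0 < r" and r2: "r\<^sup>2 = exp s - 1" using s by (auto simp: r_def)
  have e: "exp (2 * s) = e ^ 4" "exp (3 * s / 2) = e ^ 3"
    by (auto simp: e_def simp flip: exp_of_nat_mult)
  have sc: "kolmogorov_kernel (r\<^sup>2) (v', z') = 1 / r ^ 4 * kolmogorov_kernel 1 (v' / r, z' / r ^ 3)" for v' z'
  proof -
    have "3 * z'\<^sup>2 + (2 * r\<^sup>2 * v' - 3 * z')\<^sup>2 = (r ^ 3)\<^sup>2 * (3 * (z' / r ^ 3)\<^sup>2 + (2 * (v' / r) - 3 * (z' / r ^ 3))\<^sup>2)"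
      using r by (simp add: field_simps power2_eq_square eval_nat_numeral)
    then have ex: "- (1 / (4 * (r\<^sup>2) ^ 3)) * (3 * z'\<^sup>2 + (2 * r\<^sup>2 * v' - 3 * z')\<^sup>2)
        = - (1 / (4 * 1 ^ 3)) * (3 * (z' / r ^ 3)\<^sup>2 + (2 * 1 * (v' / r) - 3 * (z' / r ^ 3))\<^sup>2)"
      using r by (simp add: power2_eq_square eval_nat_numeral)
    show ?thesis
      unfolding kolmogorov_kernel_def prod.case ex by (simp add: field_simps)
  qed
  show ?thesis
    using r unfolding e r2[symmetric] sc dilated_kernel_def space_scale_def datum_scale_def r_def[symmetric] e_def[symmetric]
    by (simp add: diff_divide_distrib power_divide)
qed

lemma selfsimilar_solution_eq:
  assumes f: "f \<in> borel_measurable lebesgue" and [measurable]: "f' \<in> borel_measurable borel"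
    and ae: "AE y in lborel. f y = f' y" and s: "0 < s"
  shows "selfsimilar_solution f s x
    = (\<integral>y. dilated_kernel (kolmogorov_kernel 1) (space_scale s) (datum_scale s) x y * f' y \<partial>lborel)"
proof -
  obtain v z where x: "x = (v, z)" by (cases x)
  let ?X = "(exp (s / 2) * v, exp (3 * s / 2) * z)"
  have "selfsimilar_solution f s x
      = exp (2 * s) * (\<integral>w. kolmogorov_kernel (exp s - 1) w * f (?X - w) \<partial>lebesgue)"
    using s by (simp add: selfsimilar_solution_def kolmogorov_solution_def x split_beta' minus_prod_def)
  also have "\<dots> = exp (2 * s) * (\<integral>y. kolmogorov_kernel (exp s - 1) (?X - y) * f' y \<partial>lborel)"
    by (simp add: lebesgue_convolution_eq_lborel[OF f _ ae])
  also have "\<dots> = (\<integral>y. exp (2 * s) * kolmogorov_kernel (exp s - 1) (?X - y) * f' y \<partial>lborel)"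
    by (simp add: mult.assoc)
  also have "\<dots> = (\<integral>y. dilated_kernel (kolmogorov_kernel 1) (space_scale s) (datum_scale s) x y * f' y \<partial>lborel)"
    using rescaled_kernel_eq[OF s, of v "fst y" z "snd y" for y] by (simp add: x minus_prod_def)
  finally show ?thesis .
qed

section \<open>Convergence to the self-similar profile\<close>

theorem theorem3p2:
  fixes p :: ennreal and f0 :: "real \<times> real \<Rightarrow> real"
  assumes "1 \<le> p"
    and "f0 \<in> Lp_space lebesgue 1"
    and "f0 \<in> Lp_space lebesgue p"
    and "p = \<infinity> \<Longrightarrow> continuous_on UNIV f0"
  defines "M0 \<equiv> (\<integral>x. f0 x \<partial>lebesgue)"
  shows "((\<lambda>s. Lp_norm lebesgue p
            (\<lambda>x. selfsimilar_solution f0 s x - M0 * kolmogorov_kernel 1 x)) \<longlongrightarrow> 0) at_top"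
proof -
  let ?G = "kolmogorov_kernel 1"
  let ?K = "\<lambda>s. dilated_kernel ?G (space_scale s) (datum_scale s)"
  have f0: "integrable lebesgue f0" using assms(2) by (rule Lp_space_1_integrable)
  then have f0_meas: "f0 \<in> borel_measurable lebesgue" by auto
  obtain f where [measurable]: "f \<in> borel_measurable borel" and ae: "AE y in lborel. f0 y = f y"
    using completion_ex_borel_measurable_real[OF f0_meas] by auto
  have "integrable lebesgue f"
    using f0 by (rule integrable_cong_AE_imp) (use ae in \<open>auto intro!: AE_completion measurable_completion elim: eventually_mono\<close>)
  then have f: "integrable lborel f" by (simp add: integrable_completion)
  have "M0 = (\<integral>y. f y \<partial>lebesgue)"
    unfolding M0_def
  proof (rule integral_cong_AE[OF f0_meas])
    show "f \<in> borel_measurable lebesgue" by (intro measurable_completion) simp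
  qed (use ae in \<open>rule AE_completion\<close>)
  then have M0: "M0 = (\<integral>y. f y \<partial>lborel)"
    by (simp add: integral_completion)
  define h where "h s x = (\<integral>y. ?K s x y * f y \<partial>lborel) - (\<integral>y. f y \<partial>lborel) * ?G x" for s x
  have Kf: "integrable lborel (\<lambda>y. ?K s x y * f y)" for s x
    using kernel_one_nonneg kernel_one_le_1 f by (intro dilated_kernel_integrable[where B=1]) auto
  have a: "\<forall>\<^sub>F s in at_top. 0 < space_scale s \<and> space_scale s \<le> 2"
    using order_tendstoD[OF space_scale_tendsto, of 0] order_tendstoD[OF space_scale_tendsto, of 2]
    by (auto elim: eventually_elim2)
  have cont: "continuous_on UNIV ?G"
    using kernel_one_lipschitz by (rule lipschitz_on_continuous_on)
  have L1: "((\<lambda>s. \<integral>\<^sup>+x. \<bar>h s x\<bar> \<partial>lborel) \<longlongrightarrow> 0) at_top"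
    unfolding h_def
  proof (rule kernel_average_L1_limit[OF kernel_one_integrable kernel_one_nonneg f])
    show "\<forall>\<^sub>F s in at_top. \<forall>y. (\<integral>\<^sup>+x. ?K s x y \<partial>lborel) = (\<integral>\<^sup>+x. ?G x \<partial>lborel)"
      using a by eventually_elim (auto intro!: dilated_kernel_mass kernel_one_nonneg)
  qed (auto simp: dilated_kernel_def kernel_one_nonneg
         intro!: Kf[unfolded dilated_kernel_def] dilated_kernel_measurable[unfolded dilated_kernel_def]
           dilated_kernel_tendsto[unfolded dilated_kernel_def] cont space_scale_tendsto datum_scale_tendsto)
  \<comment> \<open>The average with \<open>?K s\<close> contributes \<open>128 * 4\<close> and the term with \<open>?G\<close> contributes 4, both times
    the \<open>L\<^sup>1\<close> norm of \<open>f\<close>; the summand 1 keeps the constant positive for \<open>f = 0\<close>.\<close>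
  define C where "C = 516 * (\<integral>y. \<bar>f y\<bar> \<partial>lborel) + 1"
  have lip: "\<forall>\<^sub>F s in at_top. C-lipschitz_on UNIV (h s)"
    using a
  proof eventually_elim
    case (elim s)
    let ?F = "\<integral>y. \<bar>f y\<bar> \<partial>lborel"
    have "(512 * ?F)-lipschitz_on UNIV (\<lambda>x. \<integral>y. ?K s x y * f y \<partial>lborel)"
      using dilated_kernel_lipschitz[OF kernel_one_lipschitz, of "space_scale s" "datum_scale s"] elim
      by (intro kernel_average_lipschitz f Kf) auto
    moreover have "(\<bar>\<integral>y. f y \<partial>lborel\<bar> * 4)-lipschitz_on UNIV (\<lambda>x. (\<integral>y. f y \<partial>lborel) * ?G x)"
      using lipschitz_on_cmult_real[OF kernel_one_lipschitz] by simp
    ultimately have "(512 * ?F + \<bar>\<integral>y. f y \<partial>lborel\<bar> * 4)-lipschitz_on UNIV (h s)"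
      unfolding h_def by (rule lipschitz_on_diff)
    moreover have "\<bar>\<integral>y. f y \<partial>lborel\<bar> \<le> ?F"
      by (rule integral_abs_bound)
    ultimately show ?case
      unfolding C_def by (elim lipschitz_on_le) linarith
  qed
  have C: "0 < C" unfolding C_def by (intro add_nonneg_pos mult_nonneg_nonneg) auto
  have "((\<lambda>s. Lp_norm lebesgue p (h s)) \<longlongrightarrow> 0) at_top"
  proof (rule Lp_norm_tendsto_zero[OF assms(1) _ L1])
    show "\<forall>\<^sub>F s in at_top. h s \<in> borel_measurable borel"
      using lip by eventually_elim (auto intro: borel_measurable_continuous_onI lipschitz_on_continuous_on)
    show "\<forall>\<^sub>F s in at_top. \<forall>x. \<bar>h s x\<bar> < e" if "0 < e" for e
      using lip C L1 that by (rule uniform_limit_of_L1_limit)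
  qed
  moreover have "\<forall>\<^sub>F s in at_top. h s = (\<lambda>x. selfsimilar_solution f0 s x - M0 * ?G x)"
    using eventually_gt_at_top[of "0::real"]
    by eventually_elim (auto simp: h_def M0 selfsimilar_solution_eq[OF f0_meas _ ae])
  then have "\<forall>\<^sub>F s in at_top. Lp_norm lebesgue p (h s)
      = Lp_norm lebesgue p (\<lambda>x. selfsimilar_solution f0 s x - M0 * ?G x)"
    by eventually_elim simp
  ultimately show ?thesis
    by (rule Lim_transform_eventually)
qed

end
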